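(* Let $\varphi$ be a univalent analytic function on $\mathbb{D}$ with positive real part which maps $\mathbb{D}$ onto a region that is starlike with respect to $1$ and symmetric with respect to the real axis, normalized by $\varphi(0)=1$ and $\varphi'(0)>0$, and write $\varphi(z)=1+B_1z+B_2z^2+\cdots$ (so $B_1>0$). Let $\mu\in\mathbb{C}$. Then for every function $f(z)=z+a_2z^2+a_3z^3+\cdots$ in the class $\mathcal{K}_s(\varphi)$, \[ |a_3-\mu a_2^2|\leq \frac13+\max\left(\frac{B_1}{3},\ \left|\frac{B_2}{3}-\frac{\mu B_1^2}{4}\right|\right), \] and this estimate is sharp (for each $\mu\in\mathbb{C}$ equality holds for some $f\in\mathcal{K}_s(\varphi)$).
   Context: $\mathbb{D}=\{z\in\mathbb{C}:|z|<1\}$. $\mathcal{A}$ is the class of analytic functions $f$ on $\mathbb{D}$ with $f(0)=0$ and $f'(0)=1$. $S^*(1/2)$ is the class of functions $g\in\mathcal{A}$ that are starlike of order $1/2$, i.e. $\operatorname{Re}(zg'(z)/g(z))>1/2$ for all $z\in\mathbb{D}$ (the quotient taking the value $1$ at $z=0$). Subordination: for $p,q$ analytic in $\mathbb{D}$, $p\prec q$ means that there is an analytic function $w$ on $\mathbb{D}$ with $w(0)=0$ and $|w(z)|<1$ such that $p(z)=q(w(z))$ for all $z\in\mathbb{D}$. For a function $\varphi$ analytic on $\mathbb{D}$ with positive real part, $\mathcal{K}_s(\varphi)$ is the class of functions $f\in\mathcal{A}$ for which there exists $g\in S^*(1/2)$ such that \[ -\frac{z^2f'(z)}{g(z)g(-z)}\prec\varphi(z)\quad(z\in\mathbb{D}),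 \] where the left-hand side is extended to $z=0$ by its limit value $1$. *)

theory Defs
  imports "HOL-Complex_Analysis.Complex_Analysis"
begin

abbreviation unit_disc :: "complex set" where
  "unit_disc \<equiv> ball 0 1"

(* Functions are total on the complex plane; only their values on unit_disc matter. *)
definition class_A :: "(complex \<Rightarrow> complex) set" where
  "class_A = {f. f holomorphic_on unit_disc \<and> f 0 = 0 \<and> deriv f 0 = 1}"

(* The conjunct g z \<noteq> 0 makes explicit that the quotient has to be defined off the origin. *)
definition starlike_half :: "(complex \<Rightarrow> complex) set" where
  "starlike_half = {g \<in> class_A.
     (\<forall>z\<in>unit_disc - {0}. g z \<noteq> 0) \<and>
     (\<forall>z\<in>unit_disc. Re (if z = 0 then 1 else z * deriv g z / g z) > 1/2)}"

definition subordinate :: "(complex \<Rightarrow> complex) \<Rightarrow> (complex \<Rightarrow> complex) \<Rightarrow> bool" where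
  "subordinate p q \<longleftrightarrow>
     p holomorphic_on unit_disc \<and> q holomorphic_on unit_disc \<and>
     (\<exists>w. w holomorphic_on unit_disc \<and> w 0 = 0 \<and> (\<forall>z\<in>unit_disc. cmod (w z) < 1) \<and>
          (\<forall>z\<in>unit_disc. p z = q (w z)))"

(* At z = 0 the quotient is replaced by its limit, which is 1 for f and g in class_A. *)
definition class_Ks :: "(complex \<Rightarrow> complex) \<Rightarrow> (complex \<Rightarrow> complex) set" where
  "class_Ks \<phi> = {f \<in> class_A. \<exists>g\<in>starlike_half.
     subordinate (\<lambda>z. if z = 0 then 1 else - (z^2 * deriv f z / (g z * g (- z)))) \<phi>}"

(* The library predicate starlike leaves the centre existentially quantified. *)
definition starlike_wrt :: "complex \<Rightarrow> complex set \<Rightarrow> bool" where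
  "starlike_wrt a S \<longleftrightarrow> a \<in> S \<and> (\<forall>x\<in>S. closed_segment a x \<subseteq> S)"

abbreviation taylor_coeff :: "(complex \<Rightarrow> complex) \<Rightarrow> nat \<Rightarrow> complex" where
  "taylor_coeff f n \<equiv> fps_nth (fps_expansion f 0) n"

end

(* With g z = z u z, membership in K_s means f' = u(z) u(-z) phi(w(z)) for a Schwarz function w,
   and comparing coefficients gives
     a3 - mu a2^2 = (2 u2 - u1^2) / 3 + B1/3 (w2 + t w1^2),  t = (B2 - 3/4 mu B1^2) / B1.
   Both summands reduce to |w2 + t w1^2| <= max 1 |t|, a consequence of the Schwarz-Pick inequality
   |w2| <= 1 - |w1|^2: starlikeness of order 1/2 says that z g'/g = 1 / (1 - v) for a Schwarz
   function v, and then 2 u2 - u1^2 = v2 + v1^2.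
   Equality is attained with u = 1 / (1 - e z), whose contribution e^2 / 3 has an arbitrary
   argument, and w = z or w = z^2. *)

theory Submission imports Defs begin

section \<open>Power series coefficients of functions on the disc\<close>

lemma fps_expansion_disc:
  assumes "f holomorphic_on unit_disc"
  shows "f has_fps_expansion fps_expansion f 0"
  using assms by (intro has_fps_expansion_fps_expansion) auto

text \<open>The expansion at 0 depends only on values near 0, so a pointwise identity known only on
  the disc becomes an identity of formal power series.\<close>

lemma fps_expansion_disc_eqI:
  assumes "f has_fps_expansion F" and "\<And>z. z \<in> unit_disc \<Longrightarrow> g z = f z"
  shows "fps_expansion g 0 = F"
proof (rule fps_expansion_eqI)
  have "\<forall>\<^sub>F z in nhds 0. z \<in> unit_disc"
    by (intro eventually_nhds_in_open) auto
  hence "\<forall>\<^sub>F z in nhds 0. g z = f z"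
    by eventually_elim (rule assms(2))
  thus "g has_fps_expansion F"
    using assms(1) has_fps_expansion_cong by blast
qed

lemma taylor_coeff_0: "taylor_coeff f 0 = f 0"
  by (simp add: fps_expansion_def)

lemma taylor_coeff_1: "taylor_coeff f 1 = deriv f 0"
  by (simp add: fps_expansion_def)

lemma fps_mult_nth_2:
  "fps_nth (F * G) 2 = fps_nth F 0 * fps_nth G 2 + fps_nth F 1 * fps_nth G 1 + fps_nth F 2 * fps_nth G 0"
  by (simp add: fps_mult_nth numeral_2_eq_2)

lemma fps_mult_nth_Suc_0:
  "fps_nth (F * G) (Suc 0) = fps_nth F 0 * fps_nth G 1 + fps_nth F 1 * fps_nth G 0"
  by (simp add: fps_mult_nth)

lemma fps_compose_nth_1:
  assumes "fps_nth G 0 = 0"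
  shows "fps_nth (fps_compose F G) 1 = fps_nth F 1 * fps_nth G 1"
  using assms by (simp add: fps_compose_nth)

lemma fps_compose_nth_2:
  assumes "fps_nth G 0 = 0"
  shows "fps_nth (fps_compose F G) 2 = fps_nth F 1 * fps_nth G 2 + fps_nth F 2 * fps_nth G 1 ^ 2"
  using assms by (simp add: fps_compose_nth numeral_2_eq_2 fps_mult_nth)

section \<open>Coefficient bounds for Schwarz functions\<close>

text \<open>These are the conditions that \<open>subordinate\<close> puts on its inner
  function.\<close>

definition schwarz_function :: "(complex \<Rightarrow> complex) \<Rightarrow> bool" where
  "schwarz_function w \<longleftrightarrow>
     w holomorphic_on unit_disc \<and> w 0 = 0 \<and> (\<forall>z\<in>unit_disc. cmod (w z) < 1)"

text \<open>The Moebius map taking \<open>h 0\<close> to 0 turns \<open>h\<close> into a function to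
  which the Schwarz lemma applies; the composition has derivative \<open>deriv h 0\<close> divided
  by \<open>1 - cmod (h 0) ^ 2\<close> at 0.\<close>

lemma schwarz_pick_at_0:
  assumes holh: "h holomorphic_on unit_disc" and less1: "\<And>z. cmod z < 1 \<Longrightarrow> cmod (h z) < 1"
  shows "cmod (deriv h 0) \<le> 1 - cmod (h 0) ^ 2"
proof -
  define a where "a = h 0"
  have a: "cmod a < 1"
    using less1[of 0] by (simp add: a_def)
  define k where "k = Moebius_function 0 a \<circ> h"
  have "k holomorphic_on unit_disc"
    unfolding k_def using less1 Moebius_function_holomorphic[OF a]
    by (intro holomorphic_on_compose_gen[OF holh]) auto
  moreover have "k 0 = 0"
    by (simp add: k_def a_def Moebius_function_eq_zero)
  moreover have "cmod (k z) < 1" if "cmod z < 1" for z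
    using Moebius_function_norm_lt_1[OF a less1[OF that]] by (simp add: k_def)
  ultimately have le1: "cmod (deriv k 0) \<le> 1"
    using Schwarz_Lemma(2)[of k 0] by auto
  \<comment> \<open>This is the denominator of the Moebius map at \<open>h 0\<close>; being real and
    positive, it leaves the norm unchanged.\<close>
  have sq: "1 - cnj a * a = of_real (1 - cmod a ^ 2)"
    by (simp add: complex_norm_square[symmetric] mult.commute)
  have pos: "1 - cmod a ^ 2 > 0"
    using a by (simp add: power_less_one_iff)
  have "(h has_field_derivative deriv h 0) (at 0)"
    using holh by (intro holomorphic_derivI) auto
  moreover have nz: "1 - cnj a * a \<noteq> 0"
    using pos by (simp only: sq of_real_eq_0_iff)
  ultimately have "((\<lambda>z. (h z - a) / (1 - cnj a * h z)) has_field_derivative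
      ((deriv h 0 - 0) * (1 - cnj a * h 0) - (h 0 - a) * (0 - cnj a * deriv h 0))
        / ((1 - cnj a * h 0) * (1 - cnj a * h 0))) (at 0)"
    by (intro DERIV_divide DERIV_diff DERIV_const DERIV_cmult) (simp_all add: a_def)
  from DERIV_imp_deriv[OF this]
  have "deriv (\<lambda>z. (h z - a) / (1 - cnj a * h z)) 0 =
      (deriv h 0 * (1 - cnj a * a)) / ((1 - cnj a * a) * (1 - cnj a * a))"
    by (simp add: a_def)
  also have "\<dots> = deriv h 0 / of_real (1 - cmod a ^ 2)"
    using nz unfolding sq by simp
  finally have "deriv k 0 = deriv h 0 / of_real (1 - cmod a ^ 2)"
    by (simp only: k_def Moebius_function_simple o_def)
  hence "cmod (deriv k 0) = cmod (deriv h 0) / (1 - cmod a ^ 2)"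
    using pos by (simp only: norm_divide norm_of_real abs_of_pos)
  with le1 pos show ?thesis
    by (simp add: field_simps a_def)
qed

text \<open>After the division \<open>w z = z * h z\<close> the two coefficients are
  \<open>h 0\<close> and \<open>deriv h 0\<close>. If \<open>h\<close> stays in the open disc,
  Schwarz-Pick applies to it; otherwise \<open>w\<close> is a rotation, whose coefficients have
  moduli 1 and 0.\<close>

lemma schwarz_function_coeff_2:
  assumes "schwarz_function w"
  shows "cmod (taylor_coeff w 2) \<le> 1 - cmod (taylor_coeff w 1) ^ 2"
proof -
  have holw: "w holomorphic_on unit_disc" and w0: "w 0 = 0"
    and less1: "\<And>z. cmod z < 1 \<Longrightarrow> cmod (w z) < 1"
    using assms by (auto simp: schwarz_function_def)
  obtain h where holh: "h holomorphic_on unit_disc"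
    and wh: "\<And>z. cmod z < 1 \<Longrightarrow> w z = z * h z"
    using Schwarz3[OF holw w0] by metis
  have "fps_expansion w 0 = fps_X * fps_expansion h 0"
    using wh by (intro fps_expansion_disc_eqI[where f = "\<lambda>z. z * h z"] fps_expansion_intros
        fps_expansion_disc holh) auto
  hence coeffs: "taylor_coeff w 1 = h 0" "taylor_coeff w 2 = deriv h 0"
    using taylor_coeff_0[of h] taylor_coeff_1[of h] by simp_all
  note schwarz = Schwarz_Lemma[OF holw w0 less1]
  show ?thesis
  proof (cases "\<exists>z. cmod z < 1 \<and> cmod (h z) \<ge> 1")
    case False
    thus ?thesis
      unfolding coeffs by (intro schwarz_pick_at_0 holh) force
  next
    case True
    then obtain z where z: "cmod z < 1" "cmod (h z) \<ge> 1" by blast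
    have "deriv w 0 = h 0"
      using coeffs taylor_coeff_1 by metis
    \<comment> \<open>A point with \<open>cmod (h z) \<ge> 1\<close> is an equality case of the
      Schwarz lemma: for the value of \<open>w\<close> if \<open>z \<noteq> 0\<close>, for its
      derivative if \<open>z = 0\<close>.\<close>
    hence "(\<exists>z. cmod z < 1 \<and> z \<noteq> 0 \<and> cmod (w z) = cmod z) \<or> cmod (deriv w 0) = 1"
      using z schwarz(1)[of z] schwarz(2)[of 0] wh[of z]
      by (cases "z = 0") (auto simp: norm_mult intro!: exI[of _ z])
    then obtain \<alpha> where \<alpha>: "\<And>z. cmod z < 1 \<Longrightarrow> w z = \<alpha> * z" "cmod \<alpha> = 1"
      using schwarz(3)[of 0] by auto
    have "fps_expansion w 0 = fps_const \<alpha> * fps_X"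
      by (intro fps_expansion_disc_eqI[where f = "\<lambda>z. \<alpha> * z"] fps_expansion_intros)
        (simp add: \<alpha>)
    thus ?thesis
      using \<alpha>(2) by simp
  qed
qed

text \<open>With \<open>x\<close> the squared modulus of the first coefficient, the triangle
  inequality leaves a convex combination of 1 and \<open>cmod t\<close> with weights
  \<open>1 - x\<close> and \<open>x\<close>.\<close>

lemma schwarz_function_fekete_szego:
  assumes "schwarz_function w"
  shows "cmod (taylor_coeff w 2 + t * taylor_coeff w 1 ^ 2) \<le> max 1 (cmod t)"
proof -
  define x where "x = cmod (taylor_coeff w 1) ^ 2"
  have bound: "cmod (taylor_coeff w 2) \<le> 1 - x"
    using schwarz_function_coeff_2[OF assms] by (simp add: x_def)
  \<comment> \<open>The upper bound on \<open>x\<close> holds because \<open>1 - x\<close> dominates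
    a norm.\<close>
  hence x: "0 \<le> x" "x \<le> 1"
    using norm_ge_zero[of "taylor_coeff w 2"] by (simp add: x_def, linarith)
  have "cmod (taylor_coeff w 2 + t * taylor_coeff w 1 ^ 2) \<le> (1 - x) * 1 + x * cmod t"
    using norm_triangle_ineq[of "taylor_coeff w 2" "t * taylor_coeff w 1 ^ 2"] bound
    by (simp add: norm_mult norm_power x_def mult.commute)
  also have "\<dots> \<le> (1 - x) * max 1 (cmod t) + x * max 1 (cmod t)"
    using x by (intro add_mono mult_left_mono) auto
  finally show ?thesis by (simp add: algebra_simps)
qed

section \<open>Starlike functions of order 1/2\<close>

text \<open>The Schwarz function \<open>\<omega>\<close> belonging to \<open>g\<close> has the
  coefficients u1 and 2 u2 - 2 u1^2 in terms of those of \<open>u\<close>, so 2 u2 - u1^2 is its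
  Fekete-Szego functional with parameter 1. This combination matters as the second coefficient of
  \<open>u z * u (- z)\<close>.\<close>

lemma starlike_half_factor:
  assumes "g \<in> starlike_half"
  obtains u where "u holomorphic_on unit_disc" "u 0 = 1"
    "\<And>z. z \<in> unit_disc \<Longrightarrow> g z = z * u z"
    "cmod (2 * taylor_coeff u 2 - taylor_coeff u 1 ^ 2) \<le> 1"
proof -
  have holg: "g holomorphic_on unit_disc" and g0: "g 0 = 0" and g1: "deriv g 0 = 1"
    and gnz: "\<And>z. cmod z < 1 \<Longrightarrow> z \<noteq> 0 \<Longrightarrow> g z \<noteq> 0"
    and Re_gt: "\<And>z. cmod z < 1 \<Longrightarrow> z \<noteq> 0 \<Longrightarrow> Re (z * deriv g z / g z) > 1/2"
    using assms by (auto simp: starlike_half_def class_A_def split: if_splits)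
  obtain u where holu: "u holomorphic_on unit_disc"
    and gu: "\<And>z. cmod z < 1 \<Longrightarrow> g z = z * u z" and u0: "u 0 = 1"
    using Schwarz3[OF holg g0] g1 by metis
  have unz: "u z \<noteq> 0" if "cmod z < 1" for z
    using gnz[OF that] gu[OF that] u0 by (cases "z = 0") auto
  \<comment> \<open>Logarithmic differentiation of \<open>g z = z * u z\<close>: this formula
    continues \<open>z * deriv g z / g z\<close> to the origin with the value 1.\<close>
  define p where "p z = 1 + z * deriv u z / u z" for z
  have p_eq: "p z = z * deriv g z / g z" if z: "cmod z < 1" "z \<noteq> 0" for z
  proof -
    have "(u has_field_derivative deriv u z) (at z)"
      using holu z by (intro holomorphic_derivI) auto
    hence "((\<lambda>z. z * u z) has_field_derivative u z + z * deriv u z) (at z)"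
      by (auto intro!: derivative_eq_intros)
    moreover have "\<forall>\<^sub>F x in nhds z. x \<in> unit_disc"
      using z by (intro eventually_nhds_in_open) auto
    hence "\<forall>\<^sub>F x in nhds z. g x = x * u x"
      by eventually_elim (simp add: gu)
    ultimately have "deriv g z = u z + z * deriv u z"
      by (metis DERIV_cong_ev DERIV_imp_deriv)
    thus ?thesis
      using z unz[of z] by (simp add: gu p_def field_simps)
  qed
  have Re_p: "Re (p z) > 1/2" if "cmod z < 1" for z
    using Re_gt[OF that] p_eq[OF that] by (cases "z = 0") (auto simp: p_def)
  have pnz: "p z \<noteq> 0" if "cmod z < 1" for z
    using Re_p[OF that] by auto
  have holp: "p holomorphic_on unit_disc"
    unfolding p_def using unz by (intro holomorphic_intros holu) auto
  define \<omega> where "\<omega> z = 1 - 1 / p z" for z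
  have holo: "\<omega> holomorphic_on unit_disc"
    unfolding \<omega>_def using pnz by (intro holomorphic_intros holp) auto
  have "cmod (\<omega> z) < 1" if z: "cmod z < 1" for z
  proof -
    \<comment> \<open>The left side minus the right side is \<open>1 - 2 * Re (p z)\<close>: the
      half-plane consists of the points closer to 1 than to 0.\<close>
    have "cmod (p z - 1) ^ 2 < cmod (p z) ^ 2"
      using Re_p[OF z] by (simp add: cmod_power2) (simp add: power2_eq_square algebra_simps)
    hence "cmod (p z - 1) < cmod (p z)"
      by (rule power_less_imp_less_base) simp
    moreover have "\<omega> z = (p z - 1) / p z"
      using pnz[OF z] by (simp add: \<omega>_def diff_divide_distrib)
    ultimately show ?thesis
      using pnz[OF z] by (simp add: norm_divide)
  qed
  moreover have o0: "\<omega> 0 = 0"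
    by (simp add: \<omega>_def p_def)
  ultimately have sch: "schwarz_function \<omega>"
    using holo by (simp add: schwarz_function_def)
  define U where "U = fps_expansion u 0"
  define W where "W = fps_expansion \<omega> 0"
  have U: "u has_fps_expansion U" and W: "\<omega> has_fps_expansion W"
    unfolding U_def W_def by (intro fps_expansion_disc holu holo)+
  have U0: "fps_nth U 0 = 1" and W0: "fps_nth W 0 = 0"
    by (simp_all only: U_def W_def taylor_coeff_0 u0 o0)
  \<comment> \<open>\<open>p = 1 / (1 - \<omega>)\<close> and \<open>u p = u + z u'\<close>; eliminating \<open>p\<close> avoids divisions.\<close>
  have key: "u z = (u z + z * deriv u z) * (1 - \<omega> z)" if "z \<in> unit_disc" for z
  proof -
    have "u z + z * deriv u z = u z * p z"
      using that unz[of z] by (simp add: p_def field_simps)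
    moreover have "p z * (1 - \<omega> z) = 1"
      using that pnz[of z] by (simp add: \<omega>_def)
    ultimately show ?thesis
      by (simp add: mult.assoc)
  qed
  have "(U + fps_X * fps_deriv U) * (1 - W) = U"
    by (subst (3) U_def, rule sym, rule fps_expansion_disc_eqI[OF _ key])
      (intro fps_expansion_intros U W)
  hence "fps_nth ((U + fps_X * fps_deriv U) * (1 - W)) 1 = fps_nth U 1"
    "fps_nth ((U + fps_X * fps_deriv U) * (1 - W)) 2 = fps_nth U 2"
    by simp_all
  hence 1: "2 * fps_nth U 1 - fps_nth W 1 = fps_nth U 1"
    and 2: "3 * fps_nth U 2 - 2 * fps_nth U 1 * fps_nth W 1 - fps_nth W 2 = fps_nth U 2"
    by (simp_all add: fps_mult_nth_2 fps_mult_nth_Suc_0 U0 W0 numeral_2_eq_2[symmetric] algebra_simps)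
  from 1 have W1: "fps_nth W 1 = fps_nth U 1"
    by (simp add: algebra_simps)
  have "2 * fps_nth U 2 - fps_nth U 1 ^ 2 = fps_nth W 2 + 1 * fps_nth W 1 ^ 2"
    using 2 unfolding W1 power2_eq_square by (simp add: algebra_simps)
  with schwarz_function_fekete_szego[OF sch, of 1]
  have "cmod (2 * taylor_coeff u 2 - taylor_coeff u 1 ^ 2) \<le> 1"
    by (simp only: U_def W_def norm_one max.idem)
  with that[of u] holu u0 gu show ?thesis
    by auto
qed

section \<open>Coefficients of functions in \<open>class_Ks\<close>\<close>

text \<open>The factor \<open>u z * u (- z)\<close> is even with second coefficient 2 u2 - u1^2, so
  up to second order it only adds this term to the coefficients of
  \<open>\<phi> (w z)\<close>.\<close>

lemma coeffs_of_factored_deriv: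
  assumes holf: "f holomorphic_on unit_disc" and holu: "u holomorphic_on unit_disc" and "u 0 = 1"
    and holp: "\<phi> holomorphic_on unit_disc" and "\<phi> 0 = 1" and "schwarz_function w"
    and fac: "\<And>z. z \<in> unit_disc \<Longrightarrow> deriv f z = u z * u (- z) * \<phi> (w z)"
  shows "2 * taylor_coeff f 2 = taylor_coeff \<phi> 1 * taylor_coeff w 1"
    and "3 * taylor_coeff f 3 = taylor_coeff \<phi> 1 * taylor_coeff w 2
           + taylor_coeff \<phi> 2 * taylor_coeff w 1 ^ 2 + (2 * taylor_coeff u 2 - taylor_coeff u 1 ^ 2)"
proof -
  have holw: "w holomorphic_on unit_disc" and "w 0 = 0"
    using assms by (auto simp: schwarz_function_def)
  define F U P W where defs: "F = fps_expansion f 0" "U = fps_expansion u 0"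
    "P = fps_expansion \<phi> 0" "W = fps_expansion w 0"
  have exps: "f has_fps_expansion F" "u has_fps_expansion U" "\<phi> has_fps_expansion P" "w has_fps_expansion W"
    unfolding defs by (intro fps_expansion_disc holf holu holp holw)+
  have const: "fps_nth U 0 = 1" "fps_nth P 0 = 1" "fps_nth W 0 = 0"
    by (simp_all only: defs taylor_coeff_0 assms \<open>w 0 = 0\<close>)
  have neg: "(u \<circ> uminus) has_fps_expansion fps_compose U (- fps_X)"
    by (intro fps_expansion_intros exps) auto
  have "(\<lambda>z. (u z * (u \<circ> uminus) z) * (\<phi> \<circ> w) z)
      has_fps_expansion (U * fps_compose U (- fps_X)) * fps_compose P W"
    by (intro fps_expansion_intros neg exps) (simp add: const)
  hence "fps_expansion (deriv f) 0 = (U * fps_compose U (- fps_X)) * fps_compose P W"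
    by (rule fps_expansion_disc_eqI) (simp add: fac)
  moreover have "fps_expansion (deriv f) 0 = fps_deriv F"
    by (intro fps_expansion_eqI fps_expansion_intros exps)
  ultimately have "fps_deriv F = (U * fps_compose U (- fps_X)) * fps_compose P W"
    by simp
  \<comment> \<open>Differentiation shifts the index: these coefficients are twice the second and
    three times the third coefficient of \<open>f\<close>.\<close>
  hence "fps_nth (fps_deriv F) 1 = fps_nth ((U * fps_compose U (- fps_X)) * fps_compose P W) 1"
    "fps_nth (fps_deriv F) 2 = fps_nth ((U * fps_compose U (- fps_X)) * fps_compose P W) 2"
    by simp_all
  thus "2 * taylor_coeff f 2 = taylor_coeff \<phi> 1 * taylor_coeff w 1"
    and "3 * taylor_coeff f 3 = taylor_coeff \<phi> 1 * taylor_coeff w 2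
           + taylor_coeff \<phi> 2 * taylor_coeff w 1 ^ 2 + (2 * taylor_coeff u 2 - taylor_coeff u 1 ^ 2)"
    unfolding defs[symmetric]
    using fps_compose_nth_1[of W P] fps_compose_nth_1[of "-fps_X" U]
    by (simp_all add: fps_mult_nth_2 fps_mult_nth_Suc_0 fps_compose_nth_2 const algebra_simps power2_eq_square numeral_3_eq_3[symmetric] numeral_2_eq_2[symmetric])
qed

text \<open>Writing \<open>g z = z * u z\<close> gives
  \<open>g z * g (- z) = - (z ^ 2 * u z * u (- z))\<close>, so the sign and the power of
  \<open>z\<close> cancel in the subordinated quotient. At the origin the normalizations make both
  sides 1.\<close>

lemma class_Ks_factor:
  assumes "f \<in> class_Ks \<phi>" and "\<phi> 0 = 1"
  obtains u w where "u holomorphic_on unit_disc" "u 0 = 1"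
    "cmod (2 * taylor_coeff u 2 - taylor_coeff u 1 ^ 2) \<le> 1"
    "schwarz_function w" "\<And>z. z \<in> unit_disc \<Longrightarrow> deriv f z = u z * u (- z) * \<phi> (w z)"
proof -
  obtain g w where f: "f \<in> class_A" and g: "g \<in> starlike_half" and w: "schwarz_function w"
    and sub: "\<And>z. z \<in> unit_disc \<Longrightarrow>
        (if z = 0 then 1 else - (z^2 * deriv f z / (g z * g (- z)))) = \<phi> (w z)"
    using assms(1) unfolding class_Ks_def subordinate_def schwarz_function_def by blast
  obtain u where u: "u holomorphic_on unit_disc" "u 0 = 1"
    "\<And>z. z \<in> unit_disc \<Longrightarrow> g z = z * u z"
    "cmod (2 * taylor_coeff u 2 - taylor_coeff u 1 ^ 2) \<le> 1"
    using starlike_half_factor[OF g] by blast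
  have "deriv f z = u z * u (- z) * \<phi> (w z)" if z: "z \<in> unit_disc" for z
  proof (cases "z = 0")
    case True
    thus ?thesis
      using f w assms(2) u(2) by (simp add: class_A_def schwarz_function_def)
  next
    case False
    have "g z \<noteq> 0" "g (- z) \<noteq> 0"
      using g z False by (auto simp: starlike_half_def)
    hence "u z \<noteq> 0" "u (- z) \<noteq> 0"
      using u(3)[of z] u(3)[of "- z"] z by auto
    thus ?thesis
      using False sub[OF z] u(3)[of z] u(3)[of "- z"] z
      by (simp add: field_simps power2_eq_square)
  qed
  with that u w show ?thesis by blast
qed

section \<open>Construction of extremal functions\<close>

lemma one_minus_mult_nonzero:
  fixes e z :: complex
  assumes "cmod e = 1" "cmod z < 1"
  shows "1 - e * z \<noteq> 0"
proof
  assume "1 - e * z = 0"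
  hence "cmod (e * z) = 1" by simp
  with assms show False by (simp add: norm_mult)
qed

text \<open>Clearing the denominator \<open>(1 - Re z) ^ 2 + Im z ^ 2\<close> reduces the claim to
  \<open>Re z ^ 2 + Im z ^ 2 < 1\<close>.\<close>

lemma Re_inverse_one_minus_gt_half:
  assumes "cmod z < 1"
  shows "Re (1 / (1 - z)) > 1/2"
proof -
  have "Re z ^ 2 + Im z ^ 2 < 1"
    using assms by (metis cmod_power2 norm_ge_zero power_less_one_iff pos2)
  moreover have "(1 - Re z) ^ 2 + Im z ^ 2 > 0"
    using assms complex_Re_le_cmod[of z] by (intro add_pos_nonneg) auto
  ultimately show ?thesis
    by (simp add: Re_divide field_simps power2_eq_square)
qed

text \<open>Here \<open>z * deriv g z / g z\<close> equals \<open>1 / (1 - e * z)\<close>, and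
  \<open>e * z\<close> lies in the disc again.\<close>

lemma starlike_half_geometric:
  assumes "cmod e = 1"
  shows "(\<lambda>z. z / (1 - e * z)) \<in> starlike_half"
proof -
  let ?g = "\<lambda>z. z / (1 - e * z)"
  have D: "(?g has_field_derivative 1 / (1 - e * z) ^ 2) (at z)" if "cmod z < 1" for z
    using one_minus_mult_nonzero[OF assms that]
    by (auto intro!: derivative_eq_intros simp: power2_eq_square)
  have "?g \<in> class_A"
    using one_minus_mult_nonzero[OF assms] DERIV_imp_deriv[OF D[of 0]]
    by (auto simp: class_A_def intro!: holomorphic_intros)
  moreover have "z * deriv ?g z / ?g z = 1 / (1 - e * z)" if "cmod z < 1" "z \<noteq> 0" for z
    unfolding DERIV_imp_deriv[OF D[OF that(1)]]
    using one_minus_mult_nonzero[OF assms that(1)] that(2)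
    by (simp add: divide_simps power2_eq_square)
  moreover have "Re (1 / (1 - e * z)) > 1/2" if "cmod z < 1" for z
    using that assms by (intro Re_inverse_one_minus_gt_half) (simp add: norm_mult)
  ultimately show ?thesis
    using one_minus_mult_nonzero[OF assms] by (auto simp: starlike_half_def)
qed

text \<open>The function \<open>f\<close> is a primitive of
  \<open>u z * u (- z) * \<phi> (w z)\<close> with \<open>u z = 1 / (1 - e * z)\<close>. As u1 = e
  and u2 = e^2, the term 2 u2 - u1^2 is \<open>e ^ 2\<close>: it attains the bound 1, and its
  argument remains free.\<close>

lemma class_Ks_member:
  assumes e: "cmod e = 1" and holp: "\<phi> holomorphic_on unit_disc" and p0: "\<phi> 0 = 1"
    and w: "schwarz_function w"
  obtains f where "f \<in> class_Ks \<phi>"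
    "2 * taylor_coeff f 2 = taylor_coeff \<phi> 1 * taylor_coeff w 1"
    "3 * taylor_coeff f 3 = taylor_coeff \<phi> 1 * taylor_coeff w 2
       + taylor_coeff \<phi> 2 * taylor_coeff w 1 ^ 2 + e ^ 2"
proof -
  define u where "u z = 1 / (1 - e * z)" for z
  have unz: "1 - e * z \<noteq> 0" if "cmod z < 1" for z
    using one_minus_mult_nonzero[OF e that] .
  have holu: "u holomorphic_on unit_disc"
    unfolding u_def using unz by (intro holomorphic_intros) auto
  have holw: "w holomorphic_on unit_disc" and w0: "w 0 = 0"
    and less1: "\<And>z. z \<in> unit_disc \<Longrightarrow> cmod (w z) < 1"
    using w by (auto simp: schwarz_function_def)
  have holpw: "(\<lambda>z. \<phi> (w z)) holomorphic_on unit_disc"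
    using holomorphic_on_compose_gen[OF holw holp] less1 by (simp add: o_def image_subset_iff)
  have "(\<lambda>z. u (- z)) holomorphic_on unit_disc"
    using holomorphic_on_compose_gen[OF holomorphic_on_minus[OF holomorphic_on_ident] holu]
    by (simp add: o_def image_subset_iff)
  hence "(\<lambda>z. u z * u (- z) * \<phi> (w z)) holomorphic_on unit_disc"
    by (intro holomorphic_intros holu holpw)
  then obtain f0 where f0: "\<And>z. z \<in> unit_disc \<Longrightarrow>
      (f0 has_field_derivative u z * u (- z) * \<phi> (w z)) (at z within unit_disc)"
    by (rule holomorphic_convex_primitive'[OF convex_ball open_ball]) (rule that, blast)
  \<comment> \<open>The shift gives \<open>f 0 = 0\<close>; the derivative at 0 is 1 because
    \<open>u 0\<close>, \<open>\<phi> 0\<close> are 1 and \<open>w 0\<close> is 0.\<close>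
  define f where "f z = f0 z - f0 0" for z
  have D: "(f has_field_derivative u z * u (- z) * \<phi> (w z)) (at z)" if "z \<in> unit_disc" for z
    using DERIV_diff[OF f0[OF that] DERIV_const] that
    by (simp add: f_def[abs_def] at_within_open[of _ unit_disc])
  note fac = DERIV_imp_deriv[OF D]
  have holf: "f holomorphic_on unit_disc"
    unfolding holomorphic_on_open[OF open_ball] using D by blast
  have A: "f \<in> class_A"
    using holf fac[of 0] by (simp add: class_A_def f_def u_def w0 p0)
  define g where "g z = z / (1 - e * z)" for z
  define q where "q z = (if z = 0 then 1 else - (z^2 * deriv f z / (g z * g (- z))))" for z
  have q_eq: "q z = \<phi> (w z)" if "z \<in> unit_disc" for z
  proof -
    have cancel: "- (z^2 * (1 / a * (1 / b) * c) / (z / a * (- z / b))) = c"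
      if "a \<noteq> 0" "b \<noteq> 0" "z \<noteq> 0" for a b c :: complex
      using that by (simp add: field_simps power2_eq_square)
    show ?thesis
      using that unz[of z] unz[of "- z"] cancel[of "1 - e * z" "1 - e * - z" "\<phi> (w z)"]
      unfolding q_def g_def fac[OF that] u_def by (simp add: w0 p0)
  qed
  have "q holomorphic_on unit_disc"
    by (rule holomorphic_transform[OF holpw]) (simp only: q_eq)
  hence "subordinate q \<phi>"
    unfolding subordinate_def using holp holw w0 less1 q_eq by blast
  moreover have "g \<in> starlike_half"
    unfolding g_def by (rule starlike_half_geometric[OF e])
  ultimately have mem: "f \<in> class_Ks \<phi>"
    using A unfolding class_Ks_def q_def by blast
  define U where "U = fps_expansion u 0"
  have U: "u has_fps_expansion U"
    unfolding U_def by (intro fps_expansion_disc holu)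
  \<comment> \<open>With the denominator of \<open>u\<close> cleared, the coefficients of
    \<open>U\<close> follow by recursion from \<open>fps_nth U 0 = 1\<close>.\<close>
  have "fps_expansion (\<lambda>_. 1) 0 = (1 - fps_const e * fps_X) * U"
  proof (rule fps_expansion_disc_eqI)
    show "(\<lambda>z. (1 - e * z) * u z) has_fps_expansion (1 - fps_const e * fps_X) * U"
      by (intro fps_expansion_intros U)
    show "1 = (1 - e * z) * u z" if "z \<in> unit_disc" for z
      using that unz[of z] by (simp add: u_def)
  qed
  moreover have "fps_expansion (\<lambda>_. 1) 0 = (1 :: complex fps)"
    by (intro fps_expansion_eqI fps_expansion_intros)
  ultimately have "(1 - fps_const e * fps_X) * U = 1" by simp
  hence "fps_nth ((1 - fps_const e * fps_X) * U) 1 = 0" "fps_nth ((1 - fps_const e * fps_X) * U) 2 = 0"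
    by simp_all
  moreover have "fps_nth U 0 = 1"
    by (simp add: U_def taylor_coeff_0 u_def)
  ultimately have "2 * taylor_coeff u 2 - taylor_coeff u 1 ^ 2 = e ^ 2"
    by (simp add: fps_mult_nth_2 fps_mult_nth_Suc_0 power2_eq_square flip: U_def)
  moreover have "u 0 = 1"
    by (simp add: u_def)
  ultimately show ?thesis
    using that[OF mem] coeffs_of_factored_deriv[OF holf holu _ holp p0 w fac] by simp
qed

text \<open>A square root of \<open>sgn s\<close> makes \<open>e ^ 2\<close> point in the direction
  of \<open>s\<close>, where the triangle inequality is an equality.\<close>

lemma exists_unimodular_square_aligned:
  fixes s :: complex
  obtains e where "cmod e = 1" "cmod (e ^ 2 + s) = 1 + cmod s"
proof (cases "s = 0")
  case True
  with that[of 1] show ?thesis by simp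
next
  case False
  define e where "e = csqrt (sgn s)"
  have e2: "e ^ 2 = sgn s"
    by (simp add: e_def)
  have "cmod e ^ 2 = 1"
    using False by (simp add: e2 norm_sgn flip: norm_power)
  hence "cmod e = 1"
    by (simp add: power2_eq_1_iff) (use norm_ge_zero[of e] in linarith)
  moreover have "e ^ 2 + s = sgn s * of_real (1 + cmod s)"
    using False by (simp add: e2 sgn_eq field_simps)
  hence "cmod (e ^ 2 + s) = \<bar>1 + cmod s\<bar>"
    using False by (simp only: norm_mult norm_sgn norm_of_real) simp
  ultimately show ?thesis
    using that by simp
qed

section \<open>The coefficient inequality and its sharpness\<close>

theorem theorem2p1:
  fixes \<phi> :: "complex \<Rightarrow> complex" and B\<^sub>1 :: real and B\<^sub>2 \<mu> :: complex
  assumes "\<phi> holomorphic_on unit_disc"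
    and "inj_on \<phi> unit_disc"
    and "\<forall>z\<in>unit_disc. Re (\<phi> z) > 0"
    and "starlike_wrt 1 (\<phi> ` unit_disc)"
    and "cnj ` (\<phi> ` unit_disc) = \<phi> ` unit_disc"
    and "\<phi> 0 = 1"
    and "deriv \<phi> 0 \<in> \<real>" and "Re (deriv \<phi> 0) > 0"
    and "complex_of_real B\<^sub>1 = taylor_coeff \<phi> 1"
    and "B\<^sub>2 = taylor_coeff \<phi> 2"
  shows "(\<forall>f\<in>class_Ks \<phi>.
            cmod (taylor_coeff f 3 - \<mu> * (taylor_coeff f 2)^2)
              \<le> 1/3 + max (B\<^sub>1 / 3) (cmod (B\<^sub>2 / 3 - \<mu> * (complex_of_real B\<^sub>1)^2 / 4))) \<and>
         (\<exists>f\<in>class_Ks \<phi>.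
            cmod (taylor_coeff f 3 - \<mu> * (taylor_coeff f 2)^2)
              = 1/3 + max (B\<^sub>1 / 3) (cmod (B\<^sub>2 / 3 - \<mu> * (complex_of_real B\<^sub>1)^2 / 4)))"
proof -
  note holp = assms(1) and p0 = assms(6)
  have B1: "taylor_coeff \<phi> 1 = complex_of_real B\<^sub>1" and B2: "taylor_coeff \<phi> 2 = B\<^sub>2"
    using assms(9,10) by simp_all
  have pos: "B\<^sub>1 > 0"
    using assms(8,9) by (metis Re_complex_of_real taylor_coeff_1)
  define s where "s = B\<^sub>2 / 3 - \<mu> * (complex_of_real B\<^sub>1)^2 / 4"
  \<comment> \<open>Chosen to solve \<open>B\<^sub>1 / 3 * t = s\<close>, which is possible since
    \<open>B\<^sub>1\<close> is positive.\<close>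
  define t where "t = 3 * s / B\<^sub>1"
  \<comment> \<open>The functional separates into a part \<open>c / 3\<close> from the starlike
    function and a part from the Schwarz function, to be bounded independently. For the extremal
    functions \<open>c\<close> is \<open>e ^ 2\<close>.\<close>
  have functional: "a3 - \<mu> * a2 ^ 2 = c / 3 + B\<^sub>1 / 3 * (w2 + t * w1 ^ 2)"
    if "2 * a2 = B\<^sub>1 * w1" "3 * a3 = B\<^sub>1 * w2 + B\<^sub>2 * w1 ^ 2 + c" for a2 a3 c w1 w2 :: complex
  proof -
    have a: "a2 = B\<^sub>1 * w1 / 2" "a3 = (B\<^sub>1 * w2 + B\<^sub>2 * w1 ^ 2 + c) / 3"
      using that by (simp_all add: field_simps)
    show ?thesis
      using pos unfolding a t_def s_def by (simp add: field_simps power2_eq_square)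
  qed
  have max_eq: "B\<^sub>1 / 3 * max 1 (cmod t) = max (B\<^sub>1 / 3) (cmod s)"
    using pos by (simp add: t_def norm_mult norm_divide max_mult_distrib_left)
  have "cmod (taylor_coeff f 3 - \<mu> * (taylor_coeff f 2)^2) \<le> 1/3 + max (B\<^sub>1 / 3) (cmod s)"
    if f: "f \<in> class_Ks \<phi>" for f
  proof -
    obtain u w where u: "u holomorphic_on unit_disc" "u 0 = 1"
      and le1: "cmod (2 * taylor_coeff u 2 - taylor_coeff u 1 ^ 2) \<le> 1"
      and w: "schwarz_function w"
      and fac: "\<And>z. z \<in> unit_disc \<Longrightarrow> deriv f z = u z * u (- z) * \<phi> (w z)"
      using class_Ks_factor[OF f p0] by blast
    have holf: "f holomorphic_on unit_disc"
      using f by (simp add: class_Ks_def class_A_def)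
    define c where "c = 2 * taylor_coeff u 2 - taylor_coeff u 1 ^ 2"
    define d where "d = taylor_coeff w 2 + t * taylor_coeff w 1 ^ 2"
    have "taylor_coeff f 3 - \<mu> * (taylor_coeff f 2)^2 = c / 3 + B\<^sub>1 / 3 * d"
      using coeffs_of_factored_deriv[OF holf u holp p0 w fac] unfolding B1 B2 c_def d_def
      by (intro functional)
    also have "cmod \<dots> \<le> cmod c / 3 + B\<^sub>1 / 3 * cmod d"
      using pos by (intro order.trans[OF norm_triangle_ineq]) (simp add: norm_mult norm_divide)
    also have "\<dots> \<le> 1 / 3 + B\<^sub>1 / 3 * max 1 (cmod t)"
      using le1 pos schwarz_function_fekete_szego[OF w, of t] unfolding c_def d_def
      by (intro add_mono mult_left_mono divide_right_mono) auto
    finally show ?thesis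
      by (simp only: max_eq)
  qed
  moreover have "\<exists>f\<in>class_Ks \<phi>.
      cmod (taylor_coeff f 3 - \<mu> * (taylor_coeff f 2)^2) = 1/3 + max (B\<^sub>1 / 3) (cmod s)"
  proof (cases "B\<^sub>1 / 3 \<le> cmod s")
    case True
    \<comment> \<open>When \<open>cmod s\<close> is the maximum, w1 = 1 and w2 = 0 make the Schwarz
      part equal to \<open>s\<close>; then \<open>e\<close> is chosen to align \<open>e ^ 2\<close>
      with it.\<close>
    have w: "schwarz_function (\<lambda>z. z)"
      by (auto simp: schwarz_function_def intro!: holomorphic_intros)
    have W: "fps_expansion (\<lambda>z. z) 0 = (fps_X :: complex fps)"
      by (intro fps_expansion_eqI fps_expansion_intros)
    obtain e where e: "cmod e = 1" "cmod (e ^ 2 + 3 * s) = 1 + cmod (3 * s)"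
      by (rule exists_unimodular_square_aligned)
    obtain f where f: "f \<in> class_Ks \<phi>" "2 * taylor_coeff f 2 = complex_of_real B\<^sub>1 * 1"
      "3 * taylor_coeff f 3 = complex_of_real B\<^sub>1 * 0 + B\<^sub>2 * 1 ^ 2 + e ^ 2"
      using class_Ks_member[OF e(1) holp p0 w, unfolded B1 B2 W] by (auto simp: eval_nat_numeral)
    have "taylor_coeff f 3 - \<mu> * (taylor_coeff f 2)^2 = (e ^ 2 + 3 * s) / 3"
      using functional[OF f(2,3)] pos by (simp add: t_def field_simps)
    hence "cmod (taylor_coeff f 3 - \<mu> * (taylor_coeff f 2)^2) = (1 + cmod (3 * s)) / 3"
      by (simp only: norm_divide e(2)) simp
    with f(1) True show ?thesis
      by (intro bexI[of _ f]) (auto simp: norm_mult add_divide_distrib)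
  next
    case False
    \<comment> \<open>When \<open>B\<^sub>1 / 3\<close> is the maximum, w1 = 0 and w2 = 1 remove
      \<open>t\<close> and the second coefficient of \<open>f\<close>; both remaining summands are
      positive for \<open>e = 1\<close>.\<close>
    have w: "schwarz_function (\<lambda>z. z ^ 2)"
      by (auto simp: schwarz_function_def norm_power power_less_one_iff intro!: holomorphic_intros)
    have W: "fps_expansion (\<lambda>z. z ^ 2) 0 = (fps_X ^ 2 :: complex fps)"
      by (intro fps_expansion_eqI fps_expansion_intros)
    obtain f where f: "f \<in> class_Ks \<phi>" "2 * taylor_coeff f 2 = complex_of_real B\<^sub>1 * 0"
      "3 * taylor_coeff f 3 = complex_of_real B\<^sub>1 * 1 + B\<^sub>2 * 0 ^ 2 + 1"
      using class_Ks_member[of 1, OF _ holp p0 w, unfolded B1 B2 W] by (auto simp: fps_X_power_nth)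
    have "taylor_coeff f 3 - \<mu> * (taylor_coeff f 2)^2 = of_real (1 / 3 + B\<^sub>1 / 3)"
      using functional[OF f(2,3)] by simp
    hence "cmod (taylor_coeff f 3 - \<mu> * (taylor_coeff f 2)^2) = 1 / 3 + B\<^sub>1 / 3"
      using pos by (simp only: norm_of_real)
    with f(1) False show ?thesis
      by (intro bexI[of _ f]) auto
  qed
  ultimately show ?thesis
    unfolding s_def by blast
qed

end
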